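(* Let $\boldsymbol\mu$ be a random element of $\mathcal{P}(\mathbb{R})$ with distribution $P_\mu$, and suppose $\mathbb{E}\,J(\boldsymbol\mu,\nu)<+\infty$ for some $\nu\in\mathcal{P}(\mathbb{R})$. Then there exists a unique minimizer $\nu^*$ of $\nu\mapsto\mathbb{E}\,J(\boldsymbol\mu,\nu)$ over $\mathcal{P}(\mathbb{R})$ (the Fréchet barycenter of $P_\mu$), and it is given by $\nu^*=\psi_\#\mathcal{L}|_{(0,1)}$, where for almost every $x\in(0,1)$ $$\psi(x) := \arg\min_{y\in\mathbb{R}} \mathbb{E}\, g\bigl(F^{-1}_{\boldsymbol\mu}(x)-y\bigr).$$
   Context: $g\colon\mathbb{R}\to\mathbb{R}$ is a strictly convex function that attains its minimum at $0$, with $g(0)=0$. $\mathcal{P}(\mathbb{R})$ is the set of Borel probability measures on $\mathbb{R}$ with the topology of weak convergence and its Borel $\sigma$-algebra; $P_\mu$ is a probability measure on this $\sigma$-algebra. For $\mu\in\mathcal{P}(\mathbb{R})$, $F_\mu(x)=\mu((-\infty,x))$ and the quantile function is $F_\mu^{-1}(y)=\inf\{x\colon F_\mu(x)\ge y\}$ for $0<y<1$. The transportation cost is $$J(\mu,\nu) := \inf_{\gamma\in\Pi(\mu,\nu)}\int_{\mathbb{R}\times\mathbb{R}} g(x-y)\,d\gamma(x,y) = \int_0^1 g\bigl(F_\mu^{-1}(x)-F_\nu^{-1}(x)\bigr)\,dx\in[0,+\infty],$$ where $\Pi(\mu,\nu)$ is the set of probability measures on $\mathbb{R}^2$ with first marginal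 $\mu$ and second marginal $\nu$, and $\mathbb{E}\,J(\boldsymbol\mu,\nu)=\int_{\mathcal{P}(\mathbb{R})}J(\mu,\nu)\,dP_\mu(\mu)\in[0,+\infty]$. $\mathcal{L}|_{(0,1)}$ is Lebesgue measure on $(0,1)$ and $\psi_\#$ denotes push-forward of measures. *)

theory Defs
  imports "HOL-Probability.Probability"
begin

definition strictly_convex :: "(real \<Rightarrow> real) \<Rightarrow> bool" where
  "strictly_convex g \<longleftrightarrow>
     (\<forall>x y t. x \<noteq> y \<longrightarrow> 0 < t \<longrightarrow> t < 1 \<longrightarrow>
        g ((1 - t) * x + t * y) < (1 - t) * g x + t * g y)"

definition prob_measures :: "real measure set" where
  "prob_measures = {\<mu>. prob_space \<mu> \<and> sets \<mu> = sets borel}"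

text \<open>The coarsest topology on the probability measures for which integration against each
  bounded continuous function is continuous.\<close>

definition weak_topology :: "real measure topology" where
  "weak_topology = topology_generated_by
     {{\<mu> \<in> prob_measures. (\<integral>x. f x \<partial>\<mu>) \<in> U} | (f :: real \<Rightarrow> real) U.
        continuous_on UNIV f \<and> bounded (range f) \<and> open U}"

lemma topspace_weak_topology: "topspace weak_topology = prob_measures"
proof -
  have "prob_measures \<in> {{\<mu> \<in> prob_measures. (\<integral>x. f x \<partial>\<mu>) \<in> U} | (f :: real \<Rightarrow> real) U.
        continuous_on UNIV f \<and> bounded (range f) \<and> open U}"
    by (auto intro!: exI[of _ "\<lambda>_. 0"] exI[of _ UNIV])
  then show ?thesis
    unfolding weak_topology_def topology_generated_by_topspace by auto
qed

definition weak_borel :: "real measure measure" where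
  "weak_borel = sigma prob_measures {U. openin weak_topology U}"

text \<open>The distribution function with the open half-line, hence left-continuous
  (unlike \<^const>\<open>cdf\<close>).\<close>

definition left_cdf :: "real measure \<Rightarrow> real \<Rightarrow> real" where
  "left_cdf \<mu> x = measure \<mu> {..<x}"

text \<open>Meaningful only for \<open>0 < y < 1\<close>, where the set is nonempty and bounded below.\<close>

definition quantile :: "real measure \<Rightarrow> real \<Rightarrow> real" where
  "quantile \<mu> y = Inf {x. left_cdf \<mu> x \<ge> y}"

definition couplings :: "real measure \<Rightarrow> real measure \<Rightarrow> (real \<times> real) measure set" where
  "couplings \<mu> \<nu> = {\<gamma>. prob_space \<gamma> \<and> sets \<gamma> = sets borel \<and>
     distr \<gamma> borel fst = \<mu> \<and> distr \<gamma> borel snd = \<nu>}"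

text \<open>In the following definitions \<open>g\<close> is meant to be nonnegative, since
  \<^const>\<open>ennreal\<close> sends negative numbers to \<open>0\<close>.\<close>

definition transport_cost :: "(real \<Rightarrow> real) \<Rightarrow> real measure \<Rightarrow> real measure \<Rightarrow> ennreal" where
  "transport_cost g \<mu> \<nu> =
     (INF \<gamma> \<in> couplings \<mu> \<nu>. \<integral>\<^sup>+ (x, y). ennreal (g (x - y)) \<partial>\<gamma>)"

definition expected_cost ::
    "(real \<Rightarrow> real) \<Rightarrow> real measure measure \<Rightarrow> real measure \<Rightarrow> ennreal" where
  "expected_cost g P \<nu> = (\<integral>\<^sup>+ \<mu>. transport_cost g \<mu> \<nu> \<partial>P)"

definition expected_quantile_cost ::
    "(real \<Rightarrow> real) \<Rightarrow> real measure measure \<Rightarrow> real \<Rightarrow> real \<Rightarrow> ennreal" where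
  "expected_quantile_cost g P x y = (\<integral>\<^sup>+ \<mu>. ennreal (g (quantile \<mu> x - y)) \<partial>P)"

definition frechet_barycenter ::
    "(real \<Rightarrow> real) \<Rightarrow> real measure measure \<Rightarrow> real measure \<Rightarrow> bool" where
  "frechet_barycenter g P \<nu> \<longleftrightarrow> is_arg_min (expected_cost g P) (\<lambda>\<nu>. \<nu> \<in> prob_measures) \<nu>"

end

theory Submission
  imports Defs
begin

text \<open>
  On the line the optimal coupling of \<open>\<mu>\<close> and \<open>\<nu>\<close> for a convex cost of \<open>x - y\<close> pairs the quantiles of
  equal level (\<open>transport_cost_eq_quantile\<close>). By Tonelli's theorem the mean cost of \<open>\<nu>\<close> is therefore
  \<open>\<integral> h\<^sub>x(q(x)) dx\<close> over the levels \<open>0 < x < 1\<close>, where \<open>q\<close> is the quantile function of \<open>\<nu>\<close> and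
  \<open>h\<^sub>x(y) = E g(F\<^sub>\<mu>\<^sup>-\<^sup>1(x) - y)\<close>, and the problem decouples: one minimizes \<open>h\<^sub>x\<close> separately for each
  level.

  At a level where \<open>h\<^sub>x\<close> is finite somewhere, it is lower semicontinuous, tends to infinity and is
  strictly convex on its domain, hence has exactly one minimizer (\<open>mean_cost_minimizer_exists\<close>,
  \<open>mean_cost_minimizer_unique\<close>); the hypothesis that some \<open>\<nu>\<close> has finite mean cost makes almost every
  level of this kind. An exchange argument shows that the minimizer \<open>\<psi>(x)\<close> is nondecreasing in \<open>x\<close>
  (\<open>minimizer_mono\<close>); in particular \<open>\<psi>\<close> is measurable, and its law \<open>\<nu>\<^sup>*\<close> under the uniform
  distribution is defined.

  Pairing \<open>F\<^sub>\<mu>\<^sup>-\<^sup>1(x)\<close> with \<open>\<psi>(x)\<close> is a coupling of \<open>\<mu>\<close> with \<open>\<nu>\<^sup>*\<close>. So the mean cost of \<open>\<nu>\<^sup>*\<close> is at most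
  \<open>\<integral> h\<^sub>x(\<psi>(x)) dx\<close>, which is a lower bound for the mean cost of every \<open>\<nu>\<close>. If \<open>\<nu>\<close> attains this bound,
  its quantile function minimizes \<open>h\<^sub>x\<close> at almost every level, thus agrees with \<open>\<psi>\<close> almost everywhere,
  and \<open>\<nu> = \<nu>\<^sup>*\<close> because a measure is the law of its quantile function.

  That the quantile coupling is optimal is proved first for hinges \<open>(x - y - t)\<^sub>+\<close>, where a layer-cake
  formula reduces it to an inequality between masses of quadrants (\<open>comonotone_optimal_hinge\<close>).
  Optimality is inherited by nonnegative combinations, by limits from below and under reflection,
  and convex functions are limits from below of sums of hinges and reflected hinges.
\<close>

section \<open>Quantile functions\<close>

abbreviation unif01 :: "real measure" where
  "unif01 \<equiv> restrict_space lborel {0<..<1}"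

lemma space_unif01: "space unif01 = {0<..<1}"
  by (simp add: space_restrict_space)

lemma prob_space_unif01: "prob_space unif01"
  by (auto simp: space_restrict_space emeasure_restrict_space intro!: prob_spaceI)

lemma cdf_distribution_of_prob_measures:
  assumes "\<mu> \<in> prob_measures"
  shows "cdf_distribution \<mu>"
  using assms
  by (auto simp: prob_measures_def cdf_distribution_def real_distribution_def
      real_distribution_axioms_def)

text \<open>Passing from \<open>\<mu>((-\<infinity>,x))\<close> to \<open>\<mu>((-\<infinity>,x])\<close> does not change the generalized inverse:
  a level reached by the closed half-line at \<open>x\<close> is reached by the open one at every point
  beyond \<open>x\<close>, and those points have the same infimum.\<close>

lemma quantile_eq_Inf_cdf:
  assumes "\<mu> \<in> prob_measures" "0 < u" "u < 1"
  shows "quantile \<mu> u = Inf {x. u \<le> cdf \<mu> x}"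
proof -
  interpret cdf_distribution \<mu> by (rule cdf_distribution_of_prob_measures[OF assms(1)])
  let ?I = "Inf {x. u \<le> cdf \<mu> x}"
  have sub: "u \<le> cdf \<mu> x" if "u \<le> left_cdf \<mu> x" for x
  proof -
    have "left_cdf \<mu> x \<le> cdf \<mu> x"
      unfolding left_cdf_def cdf_def by (rule finite_measure_mono) auto
    then show ?thesis using that by simp
  qed
  have sup: "u \<le> left_cdf \<mu> x" if "?I < x" for x
  proof -
    have "u \<le> cdf \<mu> ?I" using pseudoinverse[OF assms(2,3)] by blast
    also have "cdf \<mu> ?I = measure \<mu> {..?I}" by (simp only: cdf_def)
    also have "\<dots> \<le> left_cdf \<mu> x"
      unfolding left_cdf_def using that
      by (intro finite_measure_mono) (auto intro: le_less_trans)
    finally show ?thesis .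
  qed
  have low: "?I \<le> x" if "u \<le> left_cdf \<mu> x" for x
    using sub[OF that] pseudoinverse[OF assms(2,3)] by blast
  show ?thesis
    unfolding quantile_def
  proof (rule cInf_eq_non_empty)
    show "{x. u \<le> left_cdf \<mu> x} \<noteq> {}" using sup[of "?I + 1"] by auto
    show "?I \<le> x" if "x \<in> {x. u \<le> left_cdf \<mu> x}" for x using that low by auto
    show "y \<le> ?I" if "\<And>x. x \<in> {x. u \<le> left_cdf \<mu> x} \<Longrightarrow> y \<le> x" for y
    proof (rule dense_ge)
      fix x assume "?I < x"
      then show "y \<le> x" using that sup by blast
    qed
  qed
qed

lemma quantile_le_iff:
  assumes "\<mu> \<in> prob_measures" "0 < u" "u < 1"
  shows "quantile \<mu> u \<le> t \<longleftrightarrow> u \<le> cdf \<mu> t"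
proof -
  interpret cdf_distribution \<mu> by (rule cdf_distribution_of_prob_measures[OF assms(1)])
  show ?thesis
    using pseudoinverse[OF assms(2,3), of t] quantile_eq_Inf_cdf[OF assms] by simp
qed

lemma quantile_mono:
  assumes "\<mu> \<in> prob_measures" "0 < u" "u \<le> v" "v < 1"
  shows "quantile \<mu> u \<le> quantile \<mu> v"
  using assms quantile_le_iff[OF assms(1), of u "quantile \<mu> v"]
    quantile_le_iff[OF assms(1), of v "quantile \<mu> v"] by auto

lemma measurable_quantile:
  assumes "\<mu> \<in> prob_measures"
  shows "quantile \<mu> \<in> borel_measurable unif01"
proof -
  have "quantile \<mu> \<in> borel_measurable (restrict_space borel {0<..<1})"
    by (rule borel_measurable_mono_on_fnc) (auto simp: mono_on_def intro: quantile_mono[OF assms])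
  moreover have "sets unif01 = sets (restrict_space borel {0<..<1})"
    by (intro sets_restrict_space_cong) simp
  ultimately show ?thesis by (simp cong: measurable_cong_sets)
qed

lemma distr_quantile:
  assumes "\<mu> \<in> prob_measures"
  shows "distr unif01 borel (quantile \<mu>) = \<mu>"
proof -
  interpret cdf_distribution \<mu> by (rule cdf_distribution_of_prob_measures[OF assms])
  have "distr unif01 borel (quantile \<mu>) = distr unif01 borel (\<lambda>u. Inf {x. u \<le> cdf \<mu> x})"
    by (rule distr_cong) (auto simp: space_unif01 quantile_eq_Inf_cdf[OF assms])
  also have "\<dots> = \<mu>" by (rule distr_I_eq_M)
  finally show ?thesis .
qed

lemma space_weak_borel: "space weak_borel = prob_measures"
  and sets_weak_borel: "sets weak_borel = sigma_sets prob_measures {U. openin weak_topology U}"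
proof -
  have "{U. openin weak_topology U} \<subseteq> Pow prob_measures"
    using openin_subset topspace_weak_topology by auto
  then show "space weak_borel = prob_measures"
    and "sets weak_borel = sigma_sets prob_measures {U. openin weak_topology U}"
    by (simp_all add: weak_borel_def)
qed

lemma measurable_integral_weak_borel:
  fixes f :: "real \<Rightarrow> real"
  assumes "continuous_on UNIV f" "bounded (range f)"
  shows "(\<lambda>\<mu>. \<integral>x. f x \<partial>\<mu>) \<in> borel_measurable weak_borel"
proof (rule borel_measurableI)
  fix U :: "real set" assume "open U"
  then have "openin weak_topology {\<mu> \<in> prob_measures. (\<integral>x. f x \<partial>\<mu>) \<in> U}"
    unfolding weak_topology_def
    by (intro topology_generated_by_Basis) (use assms in auto)
  then have "{\<mu> \<in> prob_measures. (\<integral>x. f x \<partial>\<mu>) \<in> U} \<in> sets weak_borel"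
    by (simp add: sets_weak_borel sigma_sets.Basic)
  also have "{\<mu> \<in> prob_measures. (\<integral>x. f x \<partial>\<mu>) \<in> U}
      = (\<lambda>\<mu>. \<integral>x. f x \<partial>\<mu>) -` U \<inter> space weak_borel"
    by (auto simp: space_weak_borel)
  finally show "(\<lambda>\<mu>. \<integral>x. f x \<partial>\<mu>) -` U \<inter> space weak_borel \<in> sets weak_borel" .
qed

text \<open>The indicator of \<open>{..t}\<close> is the decreasing limit of continuous steps falling from \<open>1\<close> at \<open>t\<close>
  to \<open>0\<close> at \<open>t + 1/(n+1)\<close>.\<close>

lemma measurable_cdf_weak_borel: "(\<lambda>\<mu>. cdf \<mu> t) \<in> borel_measurable weak_borel"
proof (rule borel_measurable_LIMSEQ_real)
  show "(\<lambda>\<mu>. integral\<^sup>L \<mu> (cts_step t (t + 1 / Suc n))) \<in> borel_measurable weak_borel" for n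
  proof (rule measurable_integral_weak_borel)
    show "continuous_on UNIV (cts_step t (t + 1 / real (Suc n)))"
      by (intro uniformly_continuous_imp_continuous cts_step_uniformly_continuous) simp
    have "\<bar>cts_step t (t + 1 / real (Suc n)) x\<bar> \<le> 1" for x
      by (auto simp: cts_step_def divide_simps)
    then show "bounded (range (cts_step t (t + 1 / real (Suc n))))"
      by (auto simp: bounded_iff)
  qed
next
  fix \<mu> :: "real measure" assume "\<mu> \<in> space weak_borel"
  then interpret cdf_distribution \<mu>
    by (simp add: space_weak_borel cdf_distribution_of_prob_measures)
  have seq: "(\<lambda>n. t + 1 / real (Suc n)) \<longlonglongrightarrow> t"
    using LIMSEQ_inverse_real_of_nat_add[of t] by (simp add: divide_inverse)
  have "((cdf \<mu>) \<longlongrightarrow> cdf \<mu> t) (at_right t)"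
    using cdf_is_right_cont[of t] by (simp add: continuous_within)
  moreover have "filterlim (\<lambda>n. t + 1 / real (Suc n)) (at_right t) sequentially"
    unfolding filterlim_at using seq by auto
  ultimately have up: "(\<lambda>n. cdf \<mu> (t + 1 / real (Suc n))) \<longlonglongrightarrow> cdf \<mu> t"
    by (rule filterlim_compose)
  show "(\<lambda>n. integral\<^sup>L \<mu> (cts_step t (t + 1 / Suc n))) \<longlonglongrightarrow> cdf \<mu> t"
    by (rule tendsto_sandwich[OF always_eventually always_eventually tendsto_const up])
       (auto intro!: cdf_cts_step)
qed

text \<open>The sublevel set at \<open>t\<close> is the set \<open>u \<le> cdf \<mu> t\<close>, whose right-hand side depends measurably on
  \<open>\<mu>\<close>.\<close>

lemma measurable_quantile_pair:
  assumes "sets P = sets weak_borel"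
  shows "(\<lambda>(\<mu>, u). quantile \<mu> u) \<in> borel_measurable (P \<Otimes>\<^sub>M unif01)"
proof -
  have [measurable]: "(\<lambda>\<mu>. cdf \<mu> t) \<in> borel_measurable P" for t
    using measurable_cdf_weak_borel assms by (simp cong: measurable_cong_sets)
  have [measurable]: "(\<lambda>u. u) \<in> borel_measurable unif01"
    by (intro measurable_restrict_space1) simp
  have sp: "space P = prob_measures"
    using sets_eq_imp_space_eq[OF assms] by (simp add: space_weak_borel)
  have "{w \<in> space (P \<Otimes>\<^sub>M unif01). (case w of (\<mu>, u) \<Rightarrow> quantile \<mu> u) \<le> t}
      = {w \<in> space (P \<Otimes>\<^sub>M unif01). snd w \<le> cdf (fst w) t}" for t
    by (auto simp: space_pair_measure sp space_unif01 quantile_le_iff)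
  moreover have "{w \<in> space (P \<Otimes>\<^sub>M unif01). snd w \<le> cdf (fst w) t} \<in> sets (P \<Otimes>\<^sub>M unif01)" for t
    by measurable
  ultimately show ?thesis
    unfolding borel_measurable_iff_le by simp
qed

section \<open>Optimality of the comonotone coupling\<close>

text \<open>One inequality only: the quantile coupling is itself a coupling, so it is optimal once no other
  coupling beats it.\<close>

definition comonotone_optimal :: "(real \<Rightarrow> real) \<Rightarrow> bool" where
  "comonotone_optimal f \<longleftrightarrow> (\<forall>\<mu>\<in>prob_measures. \<forall>\<nu>\<in>prob_measures. \<forall>\<gamma>\<in>couplings \<mu> \<nu>.
     (\<integral>\<^sup>+ u. ennreal (f (quantile \<mu> u - quantile \<nu> u)) \<partial>unif01)
       \<le> (\<integral>\<^sup>+ z. ennreal (f (fst z - snd z)) \<partial>\<gamma>))"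

lemma measurable_fst_snd_plane:
  "fst \<in> borel_measurable (borel :: (real \<times> real) measure)"
  "snd \<in> borel_measurable (borel :: (real \<times> real) measure)"
  by (simp_all add: borel_prod[symmetric])

lemma couplingsD:
  assumes "\<gamma> \<in> couplings \<mu> \<nu>"
  shows "prob_space \<gamma>" "sets \<gamma> = sets borel" "space \<gamma> = UNIV"
    "fst \<in> borel_measurable \<gamma>" "snd \<in> borel_measurable \<gamma>"
    "distr \<gamma> borel fst = \<mu>" "distr \<gamma> borel snd = \<nu>"
proof -
  show *: "prob_space \<gamma>" "sets \<gamma> = sets borel"
    "distr \<gamma> borel fst = \<mu>" "distr \<gamma> borel snd = \<nu>"
    using assms by (auto simp: couplings_def)
  show "space \<gamma> = UNIV" using sets_eq_imp_space_eq[OF *(2)] by simp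
  show "fst \<in> borel_measurable \<gamma>" "snd \<in> borel_measurable \<gamma>"
    using *(2) measurable_fst_snd_plane by (simp_all cong: measurable_cong_sets)
qed

lemma nn_integral_pos_part_layer_cake:
  fixes X Y :: "'a \<Rightarrow> real"
  assumes "finite_measure M" and [measurable]: "X \<in> borel_measurable M" "Y \<in> borel_measurable M"
  shows "(\<integral>\<^sup>+ w. ennreal (max 0 (X w - Y w - t)) \<partial>M)
    = (\<integral>\<^sup>+ s. emeasure M {w \<in> space M. Y w + t \<le> s \<and> s < X w} \<partial>lborel)"
proof -
  interpret finite_measure M by fact
  interpret pair_sigma_finite M "lborel :: real measure" ..
  have "(\<integral>\<^sup>+ w. ennreal (max 0 (X w - Y w - t)) \<partial>M)
      = (\<integral>\<^sup>+ w. (\<integral>\<^sup>+ s. indicator {w. Y w + t \<le> s \<and> s < X w} w \<partial>lborel) \<partial>M)"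
  proof (rule nn_integral_cong)
    fix w
    have "(\<integral>\<^sup>+ s. indicator {w. Y w + t \<le> s \<and> s < X w} w \<partial>lborel)
        = (\<integral>\<^sup>+ s. indicator {Y w + t ..< X w} s \<partial>lborel)"
      by (intro nn_integral_cong) (auto simp: indicator_def)
    also have "\<dots> = ennreal (max 0 (X w - Y w - t))"
      by (cases "Y w + t \<le> X w") (auto simp: algebra_simps max_def)
    finally show "ennreal (max 0 (X w - Y w - t))
        = (\<integral>\<^sup>+ s. indicator {w. Y w + t \<le> s \<and> s < X w} w \<partial>lborel)" ..
  qed
  also have "\<dots> = (\<integral>\<^sup>+ s. (\<integral>\<^sup>+ w. indicator {w. Y w + t \<le> s \<and> s < X w} w \<partial>M) \<partial>lborel)"
    by (rule Fubini'[symmetric]) measurable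
  also have "\<dots> = (\<integral>\<^sup>+ s. emeasure M {w \<in> space M. Y w + t \<le> s \<and> s < X w} \<partial>lborel)"
  proof (rule nn_integral_cong)
    fix s
    have "(\<integral>\<^sup>+ w. indicator {w. Y w + t \<le> s \<and> s < X w} w \<partial>M)
        = (\<integral>\<^sup>+ w. indicator {w \<in> space M. Y w + t \<le> s \<and> s < X w} w \<partial>M)"
      by (intro nn_integral_cong) (auto simp: indicator_def)
    also have "\<dots> = emeasure M {w \<in> space M. Y w + t \<le> s \<and> s < X w}"
      by (rule nn_integral_indicator) measurable
    finally show "(\<integral>\<^sup>+ w. indicator {w. Y w + t \<le> s \<and> s < X w} w \<partial>M)
        = emeasure M {w \<in> space M. Y w + t \<le> s \<and> s < X w}" .
  qed
  finally show ?thesis .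
qed

text \<open>By the layer-cake formula the cost \<open>(x - y - t)\<^sub>+\<close> is the integral over \<open>s\<close> of the
  mass that a coupling gives to the quadrant \<open>x > s\<close>, \<open>y \<le> s - t\<close>. Whatever the coupling, this
  mass is at least \<open>a = cdf \<nu> (s - t) - cdf \<mu> s\<close> and at least \<open>0\<close>. Under the quantile coupling the
  quadrant corresponds to the levels in \<open>(cdf \<mu> s, cdf \<nu> (s - t)]\<close>, so it has mass \<open>max 0 a\<close>, the
  least possible, for every \<open>s\<close> at once.\<close>

lemma comonotone_optimal_hinge: "comonotone_optimal (\<lambda>z. max 0 (z - t))"
  unfolding comonotone_optimal_def
proof (intro ballI)
  fix \<mu> \<nu> \<gamma> assume \<mu>: "\<mu> \<in> prob_measures" and \<nu>: "\<nu> \<in> prob_measures" and "\<gamma> \<in> couplings \<mu> \<nu>"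
  note \<gamma> = couplingsD[OF this(3)]
  interpret G: prob_space \<gamma> by (rule \<gamma>)
  interpret U: prob_space unif01 by (rule prob_space_unif01)
  note [measurable] = \<gamma>(4,5)
  have "(\<integral>\<^sup>+ u. ennreal (max 0 (quantile \<mu> u - quantile \<nu> u - t)) \<partial>unif01)
      = (\<integral>\<^sup>+ s. emeasure unif01 {u \<in> space unif01. quantile \<nu> u + t \<le> s \<and> s < quantile \<mu> u} \<partial>lborel)"
    by (intro nn_integral_pos_part_layer_cake measurable_quantile \<mu> \<nu>)
       (rule U.finite_measure_axioms)
  also have "\<dots> \<le> (\<integral>\<^sup>+ s. emeasure \<gamma> {z \<in> space \<gamma>. snd z + t \<le> s \<and> s < fst z} \<partial>lborel)"
  proof (rule nn_integral_mono)
    fix s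
    have "{u \<in> space unif01. quantile \<nu> u + t \<le> s \<and> s < quantile \<mu> u}
        = {0<..<1} \<inter> {cdf \<mu> s <.. cdf \<nu> (s - t)}"
      using quantile_le_iff[OF \<nu>, of _ "s - t"] quantile_le_iff[OF \<mu>, of _ s]
      by (auto simp: space_unif01 algebra_simps not_le[symmetric])
    then have "emeasure unif01 {u \<in> space unif01. quantile \<nu> u + t \<le> s \<and> s < quantile \<mu> u}
        = emeasure lborel ({0<..<1} \<inter> {cdf \<mu> s <.. cdf \<nu> (s - t)})"
      by (simp add: emeasure_restrict_space)
    also have "\<dots> \<le> emeasure lborel {cdf \<mu> s <.. cdf \<nu> (s - t)}"
      by (rule emeasure_mono) auto
    also have "\<dots> = ennreal (cdf \<nu> (s - t) - cdf \<mu> s)"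
      by (cases "cdf \<mu> s \<le> cdf \<nu> (s - t)") (auto simp: ennreal_neg)
    also have "\<dots> \<le> emeasure \<gamma> {z \<in> space \<gamma>. snd z + t \<le> s \<and> s < fst z}"
    proof -
      have "cdf \<mu> s = G.prob {z \<in> space \<gamma>. fst z \<le> s}"
        unfolding \<gamma>(6)[symmetric] cdf_def
        by (subst measure_distr) (auto intro!: arg_cong[where f = G.prob])
      moreover have "cdf \<nu> (s - t) = G.prob {z \<in> space \<gamma>. snd z \<le> s - t}"
        unfolding \<gamma>(7)[symmetric] cdf_def
        by (subst measure_distr) (auto intro!: arg_cong[where f = G.prob])
      moreover have "G.prob {z \<in> space \<gamma>. snd z \<le> s - t}
          \<le> G.prob ({z \<in> space \<gamma>. fst z \<le> s} \<union> {z \<in> space \<gamma>. snd z + t \<le> s \<and> s < fst z})"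
        by (rule G.finite_measure_mono) auto
      moreover have "\<dots> \<le> G.prob {z \<in> space \<gamma>. fst z \<le> s}
          + G.prob {z \<in> space \<gamma>. snd z + t \<le> s \<and> s < fst z}"
        by (rule measure_Un_le) auto
      ultimately show ?thesis
        by (simp add: G.emeasure_eq_measure)
    qed
    finally show "emeasure unif01 {u \<in> space unif01. quantile \<nu> u + t \<le> s \<and> s < quantile \<mu> u}
        \<le> emeasure \<gamma> {z \<in> space \<gamma>. snd z + t \<le> s \<and> s < fst z}" .
  qed
  also have "\<dots> = (\<integral>\<^sup>+ z. ennreal (max 0 (fst z - snd z - t)) \<partial>\<gamma>)"
    by (intro nn_integral_pos_part_layer_cake[symmetric]) (auto intro: G.finite_measure_axioms)
  finally show "(\<integral>\<^sup>+ u. ennreal (max 0 (quantile \<mu> u - quantile \<nu> u - t)) \<partial>unif01)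
      \<le> (\<integral>\<^sup>+ z. ennreal (max 0 (fst z - snd z - t)) \<partial>\<gamma>)" .
qed

lemma measurable_quantile_diff:
  assumes "f \<in> borel_measurable borel" "\<mu> \<in> prob_measures" "\<nu> \<in> prob_measures"
  shows "(\<lambda>u. f (quantile \<mu> u - quantile \<nu> u)) \<in> borel_measurable unif01"
  by (intro measurable_compose[OF _ assms(1)] borel_measurable_diff measurable_quantile assms)

lemma measurable_coupling_diff:
  assumes "f \<in> borel_measurable borel" "\<gamma> \<in> couplings \<mu> \<nu>"
  shows "(\<lambda>z. f (fst z - snd z)) \<in> borel_measurable \<gamma>"
  by (intro measurable_compose[OF _ assms(1)] borel_measurable_diff couplingsD[OF assms(2)])

lemma comonotone_optimal_add:
  fixes f f' :: "real \<Rightarrow> real"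
  assumes "comonotone_optimal f" "comonotone_optimal f'"
    and "\<And>z. 0 \<le> f z" "\<And>z. 0 \<le> f' z"
    and "f \<in> borel_measurable borel" "f' \<in> borel_measurable borel"
  shows "comonotone_optimal (\<lambda>z. f z + f' z)"
  using assms(1,2) unfolding comonotone_optimal_def
  by (auto simp: assms(3,4) nn_integral_add measurable_quantile_diff[OF assms(5)]
      measurable_quantile_diff[OF assms(6)] measurable_coupling_diff[OF assms(5)]
      measurable_coupling_diff[OF assms(6)] intro!: add_mono)

lemma comonotone_optimal_scale:
  fixes f :: "real \<Rightarrow> real"
  assumes "comonotone_optimal f" "0 \<le> c" "f \<in> borel_measurable borel"
  shows "comonotone_optimal (\<lambda>z. c * f z)"
  unfolding comonotone_optimal_def
proof (intro ballI)
  fix \<mu> \<nu> \<gamma> assume m: "\<mu> \<in> prob_measures" "\<nu> \<in> prob_measures" "\<gamma> \<in> couplings \<mu> \<nu>"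
  have "ennreal c * (\<integral>\<^sup>+ u. ennreal (f (quantile \<mu> u - quantile \<nu> u)) \<partial>unif01)
      \<le> ennreal c * (\<integral>\<^sup>+ z. ennreal (f (fst z - snd z)) \<partial>\<gamma>)"
    using assms(1) m by (intro mult_left_mono) (auto simp: comonotone_optimal_def)
  then show "(\<integral>\<^sup>+ u. ennreal (c * f (quantile \<mu> u - quantile \<nu> u)) \<partial>unif01)
      \<le> (\<integral>\<^sup>+ z. ennreal (c * f (fst z - snd z)) \<partial>\<gamma>)"
    using measurable_quantile_diff[OF assms(3) m(1,2)] measurable_coupling_diff[OF assms(3) m(3)]
    by (simp add: assms(2) ennreal_mult' nn_integral_cmult)
qed

lemma comonotone_optimal_sum:
  fixes f :: "nat \<Rightarrow> real \<Rightarrow> real"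
  assumes "\<And>k. comonotone_optimal (f k)" "\<And>k z. 0 \<le> f k z"
    and "\<And>k. f k \<in> borel_measurable borel"
  shows "comonotone_optimal (\<lambda>z. \<Sum>k<N. f k z)"
proof (induction N)
  case 0
  show ?case by (simp add: comonotone_optimal_def)
next
  case (Suc N)
  then show ?case
    using assms by (auto intro!: comonotone_optimal_add sum_nonneg)
qed

text \<open>Domination from above makes the limit available on the side of the coupling, and Fatou's
  lemma on the side of the quantiles.\<close>

lemma comonotone_optimal_limit:
  fixes f :: "nat \<Rightarrow> real \<Rightarrow> real"
  assumes "\<And>n. comonotone_optimal (f n)" "\<And>n. f n \<in> borel_measurable borel"
    and "\<And>n z. f n z \<le> F z" "\<And>z. (\<lambda>n. f n z) \<longlonglongrightarrow> F z"
  shows "comonotone_optimal F"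
  unfolding comonotone_optimal_def
proof (intro ballI)
  fix \<mu> \<nu> \<gamma> assume m: "\<mu> \<in> prob_measures" "\<nu> \<in> prob_measures" "\<gamma> \<in> couplings \<mu> \<nu>"
  let ?q = "\<lambda>u. quantile \<mu> u - quantile \<nu> u"
  have "(\<integral>\<^sup>+ u. ennreal (F (?q u)) \<partial>unif01)
      = (\<integral>\<^sup>+ u. liminf (\<lambda>n. ennreal (f n (?q u))) \<partial>unif01)"
    by (intro nn_integral_cong lim_imp_Liminf[symmetric] tendsto_ennrealI assms(4)) simp
  also have "\<dots> \<le> liminf (\<lambda>n. \<integral>\<^sup>+ u. ennreal (f n (?q u)) \<partial>unif01)"
    by (intro nn_integral_liminf measurable_compose[OF _ measurable_ennreal]
        measurable_quantile_diff assms(2) m)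
  also have "\<dots> \<le> liminf (\<lambda>n. \<integral>\<^sup>+ z. ennreal (F (fst z - snd z)) \<partial>\<gamma>)"
  proof (intro Liminf_mono always_eventually allI)
    fix n
    have "(\<integral>\<^sup>+ u. ennreal (f n (?q u)) \<partial>unif01) \<le> (\<integral>\<^sup>+ z. ennreal (f n (fst z - snd z)) \<partial>\<gamma>)"
      using assms(1)[of n] m by (auto simp: comonotone_optimal_def)
    also have "\<dots> \<le> (\<integral>\<^sup>+ z. ennreal (F (fst z - snd z)) \<partial>\<gamma>)"
      by (intro nn_integral_mono ennreal_leI assms(3))
    finally show "(\<integral>\<^sup>+ u. ennreal (f n (?q u)) \<partial>unif01) \<le> (\<integral>\<^sup>+ z. ennreal (F (fst z - snd z)) \<partial>\<gamma>)" .
  qed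
  finally show "(\<integral>\<^sup>+ u. ennreal (F (?q u)) \<partial>unif01) \<le> (\<integral>\<^sup>+ z. ennreal (F (fst z - snd z)) \<partial>\<gamma>)"
    by (simp add: Liminf_const)
qed

text \<open>Reflecting the cost amounts to exchanging the two marginals.\<close>

lemma comonotone_optimal_reflect:
  fixes f :: "real \<Rightarrow> real"
  assumes "comonotone_optimal f" and [measurable]: "f \<in> borel_measurable borel"
  shows "comonotone_optimal (\<lambda>z. f (- z))"
  unfolding comonotone_optimal_def
proof (intro ballI)
  fix \<mu> \<nu> \<gamma> assume m: "\<mu> \<in> prob_measures" "\<nu> \<in> prob_measures" "\<gamma> \<in> couplings \<mu> \<nu>"
  note \<gamma> = couplingsD[OF m(3)]
  note [measurable] = \<gamma>(4,5)
  let ?s = "\<lambda>z. (snd z, fst z)"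
  have s[measurable]: "?s \<in> \<gamma> \<rightarrow>\<^sub>M borel" by (simp add: borel_prod[symmetric])
  note [measurable] = measurable_fst_snd_plane
  have "distr \<gamma> borel ?s \<in> couplings \<nu> \<mu>"
    unfolding couplings_def
    using prob_space.prob_space_distr[OF \<gamma>(1) s] \<gamma>(6,7)
    by (simp add: distr_distr comp_def)
  then have "(\<integral>\<^sup>+ u. ennreal (f (quantile \<nu> u - quantile \<mu> u)) \<partial>unif01)
       \<le> (\<integral>\<^sup>+ z. ennreal (f (fst z - snd z)) \<partial>distr \<gamma> borel ?s)"
    using assms(1) m by (auto simp: comonotone_optimal_def)
  also have "\<dots> = (\<integral>\<^sup>+ z. ennreal (f (snd z - fst z)) \<partial>\<gamma>)"
    by (subst nn_integral_distr) auto
  finally show "(\<integral>\<^sup>+ u. ennreal (f (- (quantile \<mu> u - quantile \<nu> u))) \<partial>unif01)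
       \<le> (\<integral>\<^sup>+ z. ennreal (f (- (fst z - snd z))) \<partial>\<gamma>)"
    by simp
qed

text \<open>A convex \<open>f\<close> vanishing on the negative half-line is approximated from below by nonnegative
  combinations of hinges. The weights are the second differences of \<open>f\<close> on the grid \<open>h\<int>\<close>, and the
  kinks are placed one step to the right of the grid points where these differences are taken. Hence,
  below its last kink, the combination is the piecewise linear interpolant of \<open>f\<close> on the grid,
  shifted to the right by \<open>h\<close>: the shift turns an interpolation lying above \<open>f\<close> into an
  approximation lying below.\<close>

definition hinge_sum :: "(real \<Rightarrow> real) \<Rightarrow> real \<Rightarrow> nat \<Rightarrow> real \<Rightarrow> real" where
  "hinge_sum f h N z = (\<Sum>k<N. (f ((real k + 1) * h) - 2 * f (real k * h) + f ((real k - 1) * h)) / h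
     * max 0 (z - (real k + 1) * h))"

lemma convex_mono_beyond_minimum:
  fixes g :: "real \<Rightarrow> real"
  assumes c: "convex_on UNIV g" and "\<And>z. g 0 \<le> g z" "g 0 = 0" and "0 \<le> x" "x \<le> y"
  shows "g x \<le> g y"
proof (cases "y = 0")
  case False
  then have y: "0 < y" using assms by simp
  have "g ((1 - x / y) *\<^sub>R 0 + (x / y) *\<^sub>R y) \<le> (1 - x / y) * g 0 + x / y * g y"
    using assms y by (intro convex_onD[OF c]) auto
  then have "g x \<le> x / y * g y" using y assms(3) by simp
  also have "\<dots> \<le> 1 * g y"
    using assms(4,5) y assms(2)[of y] assms(3) by (intro mult_right_mono) auto
  finally show ?thesis by simp
qed (use assms in simp)

locale convex_half =
  fixes f :: "real \<Rightarrow> real"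
  assumes convex: "convex_on UNIV f"
    and nonneg: "\<And>z. 0 \<le> f z"
    and zero: "\<And>z. z \<le> 0 \<Longrightarrow> f z = 0"
begin

lemma mono: "x \<le> y \<Longrightarrow> f x \<le> f y"
proof (cases "x \<le> 0")
  case True
  then show ?thesis by (simp add: zero nonneg)
next
  case False
  assume "x \<le> y"
  moreover have "f 0 = 0" by (rule zero) simp
  moreover from this have f0_le: "f 0 \<le> f z" for z by (simp add: nonneg)
  ultimately show ?thesis
    using False by (intro convex_mono_beyond_minimum[OF convex f0_le]) simp_all
qed

lemma second_difference_nonneg:
  "0 \<le> f ((real k + 1) * h) - 2 * f (real k * h) + f ((real k - 1) * h)"
proof -
  have "f ((1 - 1 / 2) *\<^sub>R ((real k + 1) * h) + (1 / 2) *\<^sub>R ((real k - 1) * h))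
     \<le> (1 - 1 / 2) * f ((real k + 1) * h) + 1 / 2 * f ((real k - 1) * h)"
    by (intro convex_onD[OF convex]) auto
  moreover have "(1 - 1 / 2) *\<^sub>R ((real k + 1) * h) + (1 / 2) *\<^sub>R ((real k - 1) * h) = real k * h"
    by (simp add: algebra_simps)
  ultimately show ?thesis by simp
qed

text \<open>The weights are increments of chord slopes and telescope: beyond its \<open>N\<close> kinks the sum is
  affine, with the slope of the chord of \<open>f\<close> over the cell from \<open>(N - 1)h\<close> to \<open>Nh\<close>.\<close>

lemma hinge_sum_beyond_kinks:
  assumes h: "0 < h" and "real N * h \<le> z"
  shows "hinge_sum f h N z = f ((real N - 1) * h)
    + (f (real N * h) - f ((real N - 1) * h)) / h * (z - real N * h)"
  using assms(2)
proof (induction N)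
  case 0
  have "f (- h) = 0" using h by (simp add: zero)
  then show ?case by (simp add: hinge_sum_def zero)
next
  case (Suc N)
  have le: "(real N + 1) * h \<le> z" using Suc.prems by (simp add: algebra_simps)
  then have "real N * h \<le> z" using h by (simp add: algebra_simps)
  note IH = Suc.IH[OF this]
  have "hinge_sum f h (Suc N) z = hinge_sum f h N z
     + (f ((real N + 1) * h) - 2 * f (real N * h) + f ((real N - 1) * h)) / h
       * (z - (real N + 1) * h)"
    using le by (simp add: hinge_sum_def max_def)
  also have "\<dots> = f (real N * h)
     + (f ((real N + 1) * h) - f (real N * h)) / h * (z - (real N + 1) * h)"
    unfolding IH using h by (simp add: field_simps)
  finally show ?case by (simp add: algebra_simps)
qed

lemma hinge_sum_mono: "0 < h \<Longrightarrow> M \<le> N \<Longrightarrow> hinge_sum f h M z \<le> hinge_sum f h N z"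
  unfolding hinge_sum_def using second_difference_nonneg[of _ h]
  by (intro sum_mono2) auto

lemma hinge_sum_eq_before_kinks:
  assumes "0 < h" "M \<le> N" "z \<le> (real M + 1) * h"
  shows "hinge_sum f h N z = hinge_sum f h M z"
  unfolding hinge_sum_def
proof (rule sum.mono_neutral_right)
  show "\<forall>k\<in>{..<N} - {..<M}. (f ((real k + 1) * h) - 2 * f (real k * h) + f ((real k - 1) * h)) / h
     * max 0 (z - (real k + 1) * h) = 0"
  proof
    fix k assume "k \<in> {..<N} - {..<M}"
    then have "(real M + 1) * h \<le> (real k + 1) * h" using assms(1) by (intro mult_right_mono) auto
    then have "max 0 (z - (real k + 1) * h) = 0" using assms(3) by simp
    then show "(f ((real k + 1) * h) - 2 * f (real k * h) + f ((real k - 1) * h)) / h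
     * max 0 (z - (real k + 1) * h) = 0" by simp
  qed
qed (use assms in auto)

lemma hinge_sum_bounds:
  assumes h: "0 < h"
  shows "hinge_sum f h N z \<le> f z"
    and "z \<le> real N * h \<Longrightarrow> f (z - 2 * h) \<le> hinge_sum f h N z"
proof -
  have "hinge_sum f h N z \<le> f z \<and> (z \<le> real N * h \<longrightarrow> f (z - 2 * h) \<le> hinge_sum f h N z)"
  proof (cases "z \<le> 0")
    case True
    have "hinge_sum f h N z = hinge_sum f h 0 z"
      using h True by (intro hinge_sum_eq_before_kinks) auto
    then show ?thesis using True h by (simp add: hinge_sum_def zero)
  next
    case False
    \<comment> \<open>The grid cell containing \<open>z\<close>; only the first \<open>M\<close> hinges are active there.\<close>
    define M where "M = nat \<lfloor>z / h\<rfloor>"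
    have "real M = of_int \<lfloor>z / h\<rfloor>" using False h by (simp add: M_def)
    then have "real M \<le> z / h" "z / h \<le> real M + 1" by linarith+
    then have M: "real M * h \<le> z" "z \<le> (real M + 1) * h" using h by (simp_all add: field_simps)
    let ?r = "(z - real M * h) / h"
    have r: "0 \<le> ?r" "?r \<le> 1" using M h by (simp_all add: field_simps)
    let ?d = "f (real M * h) - f ((real M - 1) * h)"
    have d: "0 \<le> ?d" using h by (simp add: mono)
    have eq: "hinge_sum f h M z = f ((real M - 1) * h) + ?d * ?r"
      using hinge_sum_beyond_kinks[OF h M(1)] by simp
    have "?d * ?r \<le> ?d * 1" "0 \<le> ?d * ?r"
      using mult_left_mono[OF r(2) d] mult_nonneg_nonneg[OF d r(1)] .
    then have lo: "f ((real M - 1) * h) \<le> hinge_sum f h M z"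
      and up: "hinge_sum f h M z \<le> f (real M * h)"
      using eq by auto
    have "hinge_sum f h N z \<le> hinge_sum f h M z"
    proof (cases "N \<le> M")
      case True then show ?thesis by (rule hinge_sum_mono[OF h])
    next
      case False then show ?thesis using hinge_sum_eq_before_kinks[OF h _ M(2), of N] by simp
    qed
    also note up
    also have "f (real M * h) \<le> f z" by (rule mono[OF M(1)])
    finally have 1: "hinge_sum f h N z \<le> f z" .
    have 2: "f (z - 2 * h) \<le> hinge_sum f h N z" if "z \<le> real N * h"
    proof -
      have "real M * h \<le> real N * h" using M(1) that by simp
      then have "M \<le> N" using h by simp
      have "f (z - 2 * h) \<le> f ((real M - 1) * h)"
        using M(2) by (intro mono) (simp add: algebra_simps)
      also note lo
      also have "hinge_sum f h M z \<le> hinge_sum f h N z" by (rule hinge_sum_mono[OF h \<open>M \<le> N\<close>])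
      finally show ?thesis .
    qed
    show ?thesis using 1 2 by simp
  qed
  then show "hinge_sum f h N z \<le> f z"
    and "z \<le> real N * h \<Longrightarrow> f (z - 2 * h) \<le> hinge_sum f h N z" by auto
qed

lemma comonotone_optimal: "comonotone_optimal f"
proof (rule comonotone_optimal_limit)
  \<comment> \<open>Step \<open>1/(n+1)\<close>, with enough hinges to reach the point \<open>n + 1\<close>.\<close>
  let ?h = "\<lambda>n. 1 / real (Suc n)" and ?N = "\<lambda>n. Suc n * Suc n"
  show "comonotone_optimal (hinge_sum f (?h n) (?N n))" for n
    unfolding hinge_sum_def
    using second_difference_nonneg[of _ "?h n"]
    by (intro comonotone_optimal_sum comonotone_optimal_scale comonotone_optimal_hinge)
       (auto intro!: mult_nonneg_nonneg divide_nonneg_nonneg)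
  show "hinge_sum f (?h n) (?N n) \<in> borel_measurable borel" for n
    unfolding hinge_sum_def by measurable
  show "hinge_sum f (?h n) (?N n) z \<le> f z" for n z
    by (rule hinge_sum_bounds) simp
  show "(\<lambda>n. hinge_sum f (?h n) (?N n) z) \<longlonglongrightarrow> f z" for z
  proof (rule tendsto_sandwich)
    show "\<forall>\<^sub>F n in sequentially. f (z - 2 * ?h n) \<le> hinge_sum f (?h n) (?N n) z"
    proof (rule eventually_sequentiallyI)
      fix n assume "nat \<lceil>z\<rceil> \<le> n"
      then have "z \<le> real (Suc n)" by linarith
      also have "\<dots> = real (?N n) * ?h n"
        unfolding of_nat_mult by (simp del: of_nat_Suc)
      finally show "f (z - 2 * ?h n) \<le> hinge_sum f (?h n) (?N n) z"
        by (intro hinge_sum_bounds(2)) (simp_all del: of_nat_Suc of_nat_mult)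
    qed
    show "\<forall>\<^sub>F n in sequentially. hinge_sum f (?h n) (?N n) z \<le> f z"
      by (intro always_eventually allI hinge_sum_bounds(1)) simp
    have "isCont f z"
      using convex_on_continuous[OF open_UNIV convex] by (simp add: continuous_on_eq_continuous_at)
    moreover have "(\<lambda>n. z - 2 * ?h n) \<longlonglongrightarrow> z - 2 * 0"
      using LIMSEQ_inverse_real_of_nat by (intro tendsto_intros) (simp add: divide_inverse)
    ultimately show "(\<lambda>n. f (z - 2 * ?h n)) \<longlonglongrightarrow> f z"
      using isCont_tendsto_compose[of z f "\<lambda>n. z - 2 * ?h n" sequentially] by simp
  qed simp
qed

end

lemma convex_half_of_convex:
  assumes c: "convex_on UNIV g" and "\<And>z. g 0 \<le> g z" "g 0 = 0"
  shows "convex_half (\<lambda>z. g (max 0 z))"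
proof
  show "convex_on UNIV (\<lambda>z. g (max 0 z))"
  proof (rule convex_onI)
    fix t x y :: real assume t: "0 < t" "t < 1"
    have "max 0 ((1 - t) *\<^sub>R x + t *\<^sub>R y) \<le> (1 - t) *\<^sub>R max 0 x + t *\<^sub>R max 0 y"
      using t by (auto intro!: add_mono mult_left_mono add_nonneg_nonneg)
    then have "g (max 0 ((1 - t) *\<^sub>R x + t *\<^sub>R y)) \<le> g ((1 - t) *\<^sub>R max 0 x + t *\<^sub>R max 0 y)"
      by (intro convex_mono_beyond_minimum[OF assms]) auto
    also have "\<dots> \<le> (1 - t) * g (max 0 x) + t * g (max 0 y)"
      using t by (intro convex_onD[OF c]) auto
    finally show "g (max 0 ((1 - t) *\<^sub>R x + t *\<^sub>R y)) \<le> (1 - t) * g (max 0 x) + t * g (max 0 y)" .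
  qed simp
qed (use assms in \<open>auto simp: max_def\<close>)

lemma convex_borel_measurable: "convex_on UNIV g \<Longrightarrow> g \<in> borel_measurable borel"
  for g :: "real \<Rightarrow> real"
  by (intro borel_measurable_continuous_onI convex_on_continuous) auto

text \<open>Splitting a convex function at its minimizer leaves an increasing half and, after reflection,
  another increasing half.\<close>

lemma comonotone_optimal_convex:
  assumes c: "convex_on UNIV g" and "\<And>z. g 0 \<le> g z" "g 0 = 0"
  shows "comonotone_optimal g"
proof -
  note [measurable] = convex_borel_measurable[OF c]
  have "convex_on UNIV (\<lambda>z. g (- z))"
  proof (rule convex_onI)
    fix t x y :: real assume t: "0 < t" "t < 1"
    have "g ((1 - t) *\<^sub>R (- x) + t *\<^sub>R (- y)) \<le> (1 - t) * g (- x) + t * g (- y)"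
      using t by (intro convex_onD[OF c]) auto
    then show "g (- ((1 - t) *\<^sub>R x + t *\<^sub>R y)) \<le> (1 - t) * g (- x) + t * g (- y)"
      by (simp add: algebra_simps)
  qed simp
  then interpret L: convex_half "\<lambda>z. g (- max 0 z)"
    using assms by (intro convex_half_of_convex[of "\<lambda>z. g (- z)"]) auto
  interpret R: convex_half "\<lambda>z. g (max 0 z)" by (rule convex_half_of_convex[OF assms])
  have "comonotone_optimal (\<lambda>z. g (max 0 z) + g (- max 0 (- z)))"
    using assms comonotone_optimal_reflect[OF L.comonotone_optimal]
    by (intro comonotone_optimal_add R.comonotone_optimal) auto
  moreover have "g (max 0 z) + g (- max 0 (- z)) = g z" for z
    using assms(3) by (simp add: max_def)
  ultimately show ?thesis by simp
qed

text \<open>The pair \<open>(X, Y)\<close> itself is a coupling of the two laws. Applied with the levelwise minimizer as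
  \<open>Y\<close>, this bounds the cost of the barycenter directly, without computing its quantile function.\<close>

lemma transport_cost_le:
  assumes g[measurable]: "g \<in> borel_measurable borel"
    and [measurable]: "X \<in> borel_measurable unif01" "Y \<in> borel_measurable unif01"
  shows "transport_cost g (distr unif01 borel X) (distr unif01 borel Y)
    \<le> (\<integral>\<^sup>+ u. ennreal (g (X u - Y u)) \<partial>unif01)"
proof -
  let ?XY = "\<lambda>u. (X u, Y u)"
  have XY[measurable]: "?XY \<in> unif01 \<rightarrow>\<^sub>M borel" by (simp add: borel_prod[symmetric])
  note [measurable] = measurable_fst_snd_plane
  have "distr unif01 borel ?XY \<in> couplings (distr unif01 borel X) (distr unif01 borel Y)"
    unfolding couplings_def using prob_space.prob_space_distr[OF prob_space_unif01 XY]
    by (simp add: distr_distr comp_def)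
  then have "transport_cost g (distr unif01 borel X) (distr unif01 borel Y)
      \<le> (\<integral>\<^sup>+ z. ennreal (g (fst z - snd z)) \<partial>distr unif01 borel ?XY)"
    unfolding transport_cost_def by (auto intro!: INF_lower2 simp: case_prod_unfold)
  also have "\<dots> = (\<integral>\<^sup>+ u. ennreal (g (X u - Y u)) \<partial>unif01)"
    by (subst nn_integral_distr) auto
  finally show ?thesis .
qed

lemma transport_cost_eq_quantile:
  assumes "convex_on UNIV g" "\<And>z. g 0 \<le> g z" "g 0 = 0"
    and m: "\<mu> \<in> prob_measures" "\<nu> \<in> prob_measures"
  shows "transport_cost g \<mu> \<nu> = (\<integral>\<^sup>+ u. ennreal (g (quantile \<mu> u - quantile \<nu> u)) \<partial>unif01)"
proof (rule antisym)
  show "transport_cost g \<mu> \<nu> \<le> (\<integral>\<^sup>+ u. ennreal (g (quantile \<mu> u - quantile \<nu> u)) \<partial>unif01)"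
    using transport_cost_le[OF convex_borel_measurable[OF assms(1)] measurable_quantile[OF m(1)]
        measurable_quantile[OF m(2)]] by (simp add: distr_quantile m)
  show "(\<integral>\<^sup>+ u. ennreal (g (quantile \<mu> u - quantile \<nu> u)) \<partial>unif01) \<le> transport_cost g \<mu> \<nu>"
    using comonotone_optimal_convex[OF assms(1-3)] m
    unfolding transport_cost_def comonotone_optimal_def
    by (auto intro!: INF_greatest simp: case_prod_unfold)
qed

section \<open>Minimizing the mean cost of a real random variable\<close>

locale strictly_convex_cost =
  fixes g :: "real \<Rightarrow> real"
  assumes strict: "strictly_convex g"
    and min_0: "\<And>x. g 0 \<le> g x"
    and g_0: "g 0 = 0"
begin

lemma nonneg: "0 \<le> g x"
  using min_0[of x] g_0 by simp

lemma convex: "convex_on UNIV g"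
proof (rule convex_onI)
  fix t x y :: real assume "0 < t" "t < 1"
  then have "g ((1 - t) * x + t * y) < (1 - t) * g x + t * g y" if "x \<noteq> y"
    using strict that unfolding strictly_convex_def by blast
  moreover have "(1 - t) * x + t * x = x" "(1 - t) * g x + t * g x = g x"
    by (simp_all add: algebra_simps)
  ultimately show "g ((1 - t) *\<^sub>R x + t *\<^sub>R y) \<le> (1 - t) * g x + t * g y"
    by (cases "x = y") auto
qed simp

lemma isCont: "isCont g x"
  using convex_on_continuous[OF open_UNIV convex] by (simp add: continuous_on_eq_continuous_at)

lemma measurable_cost [measurable]: "g \<in> borel_measurable borel"
  by (rule convex_borel_measurable[OF convex])

lemma positive: "x \<noteq> 0 \<Longrightarrow> 0 < g x"
proof -
  assume "x \<noteq> 0"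
  then have "g ((1 - 1/2) * 0 + 1/2 * x) < (1 - 1/2) * g 0 + 1/2 * g x"
    using strict unfolding strictly_convex_def
    by (metis half_gt_zero_iff zero_less_one field_sum_of_halves less_add_same_cancel1)
  then show ?thesis using nonneg[of "x / 2"] g_0 by simp
qed

text \<open>For \<open>\<bar>z\<bar> \<ge> 1\<close> convexity and \<open>g(0) = 0\<close> give \<open>\<bar>z\<bar> g(\<plusminus>1) \<le> g(z)\<close>, with the sign of \<open>z\<close>; strictness
  makes \<open>g(\<plusminus>1)\<close> positive.\<close>

lemma linear_lower_bound: "\<exists>c>0. \<forall>z. c * (\<bar>z\<bar> - 1) \<le> g z"
proof (intro exI conjI allI)
  let ?c = "min (g 1) (g (- 1))"
  show "0 < ?c" using positive by simp
  fix z
  show "?c * (\<bar>z\<bar> - 1) \<le> g z"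
  proof (cases "\<bar>z\<bar> \<le> 1")
    case True
    then have "?c * (\<bar>z\<bar> - 1) \<le> 0" using \<open>0 < ?c\<close> by (simp add: mult_nonneg_nonpos)
    then show ?thesis using nonneg[of z] by linarith
  next
    case False
    then have "g ((1 - 1 / \<bar>z\<bar>) *\<^sub>R 0 + (1 / \<bar>z\<bar>) *\<^sub>R z) \<le> (1 - 1 / \<bar>z\<bar>) * g 0 + 1 / \<bar>z\<bar> * g z"
      by (intro convex_onD[OF convex]) auto
    moreover have "z / \<bar>z\<bar> = 1 \<or> z / \<bar>z\<bar> = - 1" using False by (auto simp: abs_if)
    ultimately have "?c \<le> g z / \<bar>z\<bar>" using g_0 by auto
    then have "?c * \<bar>z\<bar> \<le> g z" using False by (simp add: pos_le_divide_eq)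
    then show ?thesis using \<open>0 < ?c\<close> unfolding right_diff_distrib by linarith
  qed
qed

text \<open>Escaping to infinity costs infinitely much and the mean cost is lower semicontinuous, both
  by Fatou's lemma; so a minimizing sequence, which always has a limit point in the extended line,
  cannot diverge and its finite limit points are minimizers.\<close>

lemma mean_cost_minimizer_exists:
  fixes X :: "'a \<Rightarrow> real"
  assumes "prob_space M" and [measurable]: "X \<in> borel_measurable M"
    and fin: "(\<integral>\<^sup>+ w. ennreal (g (X w - y0)) \<partial>M) < \<infinity>"
  shows "\<exists>y. is_arg_min (\<lambda>y. \<integral>\<^sup>+ w. ennreal (g (X w - y)) \<partial>M) (\<lambda>_. True) y"
proof -
  interpret prob_space M by fact
  define h where "h y = (\<integral>\<^sup>+ w. ennreal (g (X w - y)) \<partial>M)" for y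
  define m where "m = (INF y. h y)"
  have "m \<le> h y0" unfolding m_def by (rule INF_lower) simp
  then have "m < \<infinity>" using fin by (simp add: h_def)
  obtain F where F: "decseq F" "range F \<subseteq> range h" "m = (INF i. F i)"
    using ennreal_Inf_countable_INF[of "range h"] by (auto simp: m_def)
  have "\<forall>i. \<exists>y. F i = h y" using F(2) by blast
  then obtain y where y: "\<And>i. F i = h (y i)" by metis
  then have hy: "(\<lambda>i. h (y i)) \<longlonglongrightarrow> m"
  proof -
    have "F = (\<lambda>i. h (y i))" by (simp add: y fun_eq_iff)
    then show ?thesis using LIMSEQ_INF[OF F(1)] unfolding F(3) by simp
  qed
  obtain l r where r: "strict_mono r" and l: "((\<lambda>n. ereal (y n)) \<circ> r) \<longlonglongrightarrow> l"
    using compact_complete_linorder[of "\<lambda>n. ereal (y n)"] by blast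
  have fatou: "(\<integral>\<^sup>+ w. liminf (\<lambda>n. ennreal (g (X w - y (r n)))) \<partial>M) \<le> m"
  proof -
    have "(\<lambda>n. h (y (r n))) \<longlonglongrightarrow> m"
      using LIMSEQ_subseq_LIMSEQ[OF hy r] by (simp add: comp_def)
    then have "liminf (\<lambda>n. h (y (r n))) = m"
      by (intro lim_imp_Liminf) auto
    moreover have "(\<integral>\<^sup>+ w. liminf (\<lambda>n. ennreal (g (X w - y (r n)))) \<partial>M) \<le> liminf (\<lambda>n. h (y (r n)))"
      unfolding h_def by (intro nn_integral_liminf) measurable
    ultimately show ?thesis by simp
  qed
  have no_escape: False if esc: "filterlim (\<lambda>n. \<bar>y (r n)\<bar>) at_top sequentially"
  proof -
    obtain c where c: "0 < c" "\<And>z. c * (\<bar>z\<bar> - 1) \<le> g z" using linear_lower_bound by blast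
    have "liminf (\<lambda>n. ennreal (g (X w - y (r n)))) = top" for w
    proof -
      have "filterlim (\<lambda>n. - (\<bar>X w\<bar> + 1) + \<bar>y (r n)\<bar>) at_top sequentially"
        by (rule filterlim_tendsto_add_at_top[OF tendsto_const esc])
      then have "filterlim (\<lambda>n. c * (- (\<bar>X w\<bar> + 1) + \<bar>y (r n)\<bar>)) at_top sequentially"
        by (rule filterlim_tendsto_pos_mult_at_top[OF tendsto_const c(1)])
      then have "filterlim (\<lambda>n. g (X w - y (r n))) at_top sequentially"
      proof (rule filterlim_at_top_mono, intro always_eventually allI)
        fix n
        have "c * (- (\<bar>X w\<bar> + 1) + \<bar>y (r n)\<bar>) \<le> c * (\<bar>X w - y (r n)\<bar> - 1)"
          using c(1) by (intro mult_left_mono) auto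
        also have "\<dots> \<le> g (X w - y (r n))" by (rule c)
        finally show "c * (- (\<bar>X w\<bar> + 1) + \<bar>y (r n)\<bar>) \<le> g (X w - y (r n))" .
      qed
      then have "(\<lambda>n. ennreal (g (X w - y (r n)))) \<longlonglongrightarrow> top"
        by (simp add: ennreal_tendsto_top_eq_at_top)
      then show ?thesis by (intro lim_imp_Liminf) auto
    qed
    then have "top \<le> m" using fatou by (simp add: emeasure_space_1)
    then show False using \<open>m < \<infinity>\<close> by simp
  qed
  have "\<exists>yl. l = ereal yl"
  proof (cases l)
    case PInf
    then have "filterlim (\<lambda>n. y (r n)) at_top sequentially"
      using l by (simp add: comp_def tendsto_PInfty_eq_at_top)
    then show ?thesis using no_escape filterlim_compose[OF filterlim_abs_real] by blast
  next
    case MInf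
    then have "((\<lambda>n. ereal (- y (r n))) \<longlongrightarrow> \<infinity>) sequentially"
      using tendsto_uminus_ereal[OF l] by (simp add: comp_def)
    then have "filterlim (\<lambda>n. - y (r n)) at_top sequentially"
      by (simp add: tendsto_PInfty_eq_at_top)
    then have "filterlim (\<lambda>n. \<bar>- y (r n)\<bar>) at_top sequentially"
      using filterlim_compose[OF filterlim_abs_real] by blast
    then show ?thesis using no_escape by simp
  qed auto
  then obtain yl where "l = ereal yl" ..
  then have lim: "(\<lambda>n. y (r n)) \<longlonglongrightarrow> yl"
    using l by (simp add: comp_def)
  have "liminf (\<lambda>n. ennreal (g (X w - y (r n)))) = ennreal (g (X w - yl))" for w
    by (intro lim_imp_Liminf tendsto_ennrealI isCont_tendsto_compose[OF isCont]
        tendsto_diff tendsto_const lim) simp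
  then have "h yl \<le> m" using fatou by (simp add: h_def)
  then have "h yl \<le> h z" for z
    unfolding m_def by (meson INF_lower2 UNIV_I order_trans order_refl)
  then have "is_arg_min h (\<lambda>_. True) yl"
    by (auto simp: is_arg_min_def not_less)
  then show ?thesis unfolding h_def[abs_def] by blast
qed

text \<open>The mean cost is strictly convex where it is finite, so the midpoint of two minimizers would
  be cheaper than both.\<close>

lemma mean_cost_minimizer_unique:
  fixes X :: "'a \<Rightarrow> real"
  assumes "prob_space M" and [measurable]: "X \<in> borel_measurable M"
    and fin: "(\<integral>\<^sup>+ w. ennreal (g (X w - y0)) \<partial>M) < \<infinity>"
    and y1: "is_arg_min (\<lambda>y. \<integral>\<^sup>+ w. ennreal (g (X w - y)) \<partial>M) (\<lambda>_. True) y1"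
    and y2: "is_arg_min (\<lambda>y. \<integral>\<^sup>+ w. ennreal (g (X w - y)) \<partial>M) (\<lambda>_. True) y2"
  shows "y1 = y2"
proof (rule ccontr)
  assume ne: "y1 \<noteq> y2"
  interpret prob_space M by fact
  define h where "h y = (\<integral>\<^sup>+ w. ennreal (g (X w - y)) \<partial>M)" for y
  have le: "h y1 \<le> h y" "h y2 \<le> h y" for y
    using y1 y2 by (auto simp: is_arg_min_def not_less h_def)
  then have eq: "h y2 = h y1" by (simp add: antisym)
  have "h y1 < top" using le(1)[of y0] fin by (auto simp: h_def)
  then obtain c where c: "0 \<le> c" "h y1 = ennreal c" by (cases "h y1") auto
  let ?y = "(y1 + y2) / 2"
  let ?k = "\<lambda>w. ennreal (1/2) * (ennreal (g (X w - y1)) + ennreal (g (X w - y2)))"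
  have less: "ennreal (g (X w - ?y)) < ?k w" for w
  proof -
    have "g ((1 - 1/2) * (X w - y1) + 1/2 * (X w - y2))
        < (1 - 1/2) * g (X w - y1) + 1/2 * g (X w - y2)"
      using strict ne unfolding strictly_convex_def
      by (elim allE[of _ "X w - y1"] allE[of _ "X w - y2"] allE[of _ "1/2"]) auto
    moreover have "(1 - 1/2) * (X w - y1) + 1/2 * (X w - y2) = X w - ?y"
      by (simp add: field_simps)
    ultimately have lt: "g (X w - ?y) < 1/2 * (g (X w - y1) + g (X w - y2))" by simp
    then have "ennreal (g (X w - ?y)) < ennreal (1/2 * (g (X w - y1) + g (X w - y2)))"
      using le_less_trans[OF nonneg lt] lt by (intro ennreal_lessI)
    also have "\<dots> = ?k w"
      using nonneg by (simp only: ennreal_mult' ennreal_plus)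
    finally show ?thesis .
  qed
  have "(\<integral>\<^sup>+ w. ?k w \<partial>M) = ennreal (1/2) * (h y1 + h y2)"
    unfolding h_def by (subst nn_integral_cmult, measurable) (subst nn_integral_add, auto)
  also have "\<dots> = ennreal (1/2 * (c + c))"
    unfolding eq c(2) using c(1) by (subst ennreal_mult') (simp_all add: ennreal_plus[symmetric])
  also have "\<dots> = h y1" using c by simp
  finally have k: "(\<integral>\<^sup>+ w. ?k w \<partial>M) = h y1" .
  have "h ?y < (\<integral>\<^sup>+ w. ?k w \<partial>M)"
    unfolding h_def
  proof (rule nn_integral_less)
    have "(\<integral>\<^sup>+ w. ennreal (g (X w - ?y)) \<partial>M) \<le> h y1"
      unfolding k[symmetric] using less by (intro nn_integral_mono) (auto intro: less_imp_le)
    then show "(\<integral>\<^sup>+ w. ennreal (g (X w - ?y)) \<partial>M) \<noteq> \<infinity>" using \<open>h y1 < top\<close> by auto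
    show "AE w in M. ennreal (g (X w - ?y)) \<le> ?k w" using less by (auto intro: less_imp_le)
    show "\<not> (AE w in M. ?k w \<le> ennreal (g (X w - ?y)))"
      using less by (auto simp: not_le[symmetric] AE_False)
  qed measurable
  with k le(1)[of ?y] show False by simp
qed

text \<open>The two inner arguments on the left lie between the outer ones on the right and have the same
  sum.\<close>

lemma exchange:
  assumes "u \<le> v" "b \<le> a"
  shows "g (u - b) + g (v - a) \<le> g (u - a) + g (v - b)"
proof (cases "(v - u) + (a - b) = 0")
  case True
  then have "u = v" "a = b" using assms by auto
  then show ?thesis by simp
next
  case False
  define L where "L = (v - u) + (a - b)"
  define s where "s = (a - b) / L"
  have L: "0 < L" using False assms by (simp add: L_def)
  have s: "0 \<le> s" "s \<le> 1" using assms L by (auto simp: s_def) (simp add: L_def)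
  have sL: "s * L = a - b" using L by (simp add: s_def)
  have "(1 - s) *\<^sub>R (u - a) + s *\<^sub>R (v - b) = u - a + s * L"
    by (simp add: L_def algebra_simps)
  then have e1: "(1 - s) *\<^sub>R (u - a) + s *\<^sub>R (v - b) = u - b" by (simp add: sL)
  have "(1 - s) *\<^sub>R (v - b) + s *\<^sub>R (u - a) = v - b - s * L"
    by (simp add: L_def algebra_simps)
  then have e2: "(1 - s) *\<^sub>R (v - b) + s *\<^sub>R (u - a) = v - a" by (simp add: sL)
  have "g (u - b) \<le> (1 - s) * g (u - a) + s * g (v - b)"
    using convex_onD[OF convex s, of "u - a" "v - b"] unfolding e1 by simp
  moreover have "g (v - a) \<le> (1 - s) * g (v - b) + s * g (u - a)"
    using convex_onD[OF convex s, of "v - b" "u - a"] unfolding e2 by simp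
  ultimately show ?thesis by (simp add: algebra_simps)
qed

end

section \<open>The barycenter\<close>

lemma AE_lebesgue_on_unit_interval:
  "(AE x in lebesgue_on {0<..<1::real}. Q x) \<longleftrightarrow> (AE x in unif01. Q x)"
  by (simp add: AE_restrict_space_iff AE_completion_iff)

lemma distr_lebesgue_on_unit_interval:
  fixes f :: "real \<Rightarrow> real"
  assumes [measurable]: "f \<in> borel_measurable borel"
  shows "distr (lebesgue_on {0<..<1}) borel f = distr unif01 borel f"
proof (rule measure_eqI)
  fix A assume "A \<in> sets (distr (lebesgue_on {0<..<1}) borel f)"
  then have A[measurable]: "A \<in> sets borel" by simp
  have "f \<in> borel_measurable (lebesgue_on {0<..<1})"
    by (intro measurable_restrict_space1 measurable_completion) simp
  moreover have "f \<in> borel_measurable unif01"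
    by (intro measurable_restrict_space1) simp
  moreover have "f -` A \<inter> {0<..<1} \<in> sets borel"
    using measurable_sets[OF assms A] by simp
  ultimately show "emeasure (distr (lebesgue_on {0<..<1}) borel f) A
      = emeasure (distr unif01 borel f) A"
    by (simp add: emeasure_distr emeasure_restrict_space space_restrict_space)
qed simp

text \<open>Changing a function on a null set does not affect measurability for the completed measure.\<close>

lemma AE_eq_borel_on_unit_interval:
  fixes f \<psi> :: "real \<Rightarrow> real"
  assumes f: "f \<in> borel_measurable borel" and ae: "AE x in unif01. \<psi> x = f x"
  shows "\<psi> \<in> borel_measurable (lebesgue_on {0<..<1})"
    and "distr (lebesgue_on {0<..<1}) borel \<psi> = distr unif01 borel f"
proof -
  let ?on = "\<lambda>k x. if x \<in> {0<..<1} then k x else (0::real)"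
  have fm: "f \<in> borel_measurable (lebesgue_on {0<..<1})"
    using f by (intro measurable_restrict_space1 measurable_completion) simp
  then have "?on f \<in> borel_measurable lebesgue"
    by (subst (asm) measurable_restrict_space_iff[where c = 0]) auto
  moreover have "AE x in lebesgue. ?on f x = ?on \<psi> x"
  proof -
    have "AE x in lebesgue. x \<in> {0<..<1} \<longrightarrow> \<psi> x = f x"
      using ae by (simp add: AE_restrict_space_iff AE_completion_iff)
    then show ?thesis by eventually_elim auto
  qed
  ultimately have "?on \<psi> \<in> borel_measurable lebesgue"
    by (rule borel_measurable_AE)
  then show \<psi>m: "\<psi> \<in> borel_measurable (lebesgue_on {0<..<1})"
    by (subst measurable_restrict_space_iff[where c = 0]) auto
  have "distr (lebesgue_on {0<..<1}) borel \<psi> = distr (lebesgue_on {0<..<1}) borel f"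
    using ae \<psi>m fm by (intro distr_cong_AE) (auto simp: AE_lebesgue_on_unit_interval)
  then show "distr (lebesgue_on {0<..<1}) borel \<psi> = distr unif01 borel f"
    using distr_lebesgue_on_unit_interval[OF f] by simp
qed

locale random_measure_cost = strictly_convex_cost +
  fixes P :: "real measure measure" and \<nu>0 :: "real measure"
  assumes prob_P: "prob_space P" and sets_P: "sets P = sets weak_borel"
    and \<nu>0: "\<nu>0 \<in> prob_measures" and finite_cost: "expected_cost g P \<nu>0 < \<infinity>"
begin

sublocale P: prob_space P by (rule prob_P)
sublocale U: prob_space unif01 by (rule prob_space_unif01)
sublocale PU: pair_sigma_finite P unif01 ..

abbreviation level_cost :: "real \<Rightarrow> real \<Rightarrow> ennreal" where
  "level_cost x y \<equiv> expected_quantile_cost g P x y"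

abbreviation minimizes :: "real \<Rightarrow> real \<Rightarrow> bool" where
  "minimizes x y \<equiv> is_arg_min (level_cost x) (\<lambda>_. True) y"

lemma space_P: "space P = prob_measures"
  using sets_eq_imp_space_eq[OF sets_P] by (simp add: space_weak_borel)

lemma measurable_joint_cost:
  assumes [measurable]: "Y \<in> borel_measurable unif01"
  shows "(\<lambda>(\<mu>, u). ennreal (g (quantile \<mu> u - Y u))) \<in> borel_measurable (P \<Otimes>\<^sub>M unif01)"
proof -
  have [measurable]: "(\<lambda>z. quantile (fst z) (snd z)) \<in> borel_measurable (P \<Otimes>\<^sub>M unif01)"
    using measurable_quantile_pair[OF sets_P] by (simp add: case_prod_unfold)
  show ?thesis unfolding case_prod_unfold by measurable
qed

lemma measurable_level_cost:
  assumes "Y \<in> borel_measurable unif01"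
  shows "(\<lambda>u. level_cost u (Y u)) \<in> borel_measurable unif01"
proof -
  have "(\<lambda>(u, \<mu>). ennreal (g (quantile \<mu> u - Y u))) \<in> borel_measurable (unif01 \<Otimes>\<^sub>M P)"
    using measurable_compose[OF measurable_pair_swap' measurable_joint_cost[OF assms]]
    by (simp add: case_prod_unfold)
  then show ?thesis
    unfolding expected_quantile_cost_def by (rule P.borel_measurable_nn_integral)
qed

lemma integral_level_cost:
  assumes "Y \<in> borel_measurable unif01"
  shows "(\<integral>\<^sup>+ u. level_cost u (Y u) \<partial>unif01)
    = (\<integral>\<^sup>+ \<mu>. (\<integral>\<^sup>+ u. ennreal (g (quantile \<mu> u - Y u)) \<partial>unif01) \<partial>P)"
  unfolding expected_quantile_cost_def
  by (rule PU.Fubini'[of "\<lambda>\<mu> u. ennreal (g (quantile \<mu> u - Y u))"])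
     (rule measurable_joint_cost[OF assms])

lemma expected_cost_eq:
  assumes "\<nu> \<in> prob_measures"
  shows "expected_cost g P \<nu> = (\<integral>\<^sup>+ u. level_cost u (quantile \<nu> u) \<partial>unif01)"
  unfolding integral_level_cost[OF measurable_quantile[OF assms]] expected_cost_def
  by (intro nn_integral_cong transport_cost_eq_quantile convex min_0 g_0 assms) (simp add: space_P)

lemma expected_cost_distr_le:
  assumes "Y \<in> borel_measurable unif01"
  shows "expected_cost g P (distr unif01 borel Y) \<le> (\<integral>\<^sup>+ u. level_cost u (Y u) \<partial>unif01)"
  unfolding integral_level_cost[OF assms] expected_cost_def
proof (rule nn_integral_mono)
  fix \<mu> assume "\<mu> \<in> space P"
  then have "\<mu> \<in> prob_measures" by (simp add: space_P)
  then show "transport_cost g \<mu> (distr unif01 borel Y)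
      \<le> (\<integral>\<^sup>+ u. ennreal (g (quantile \<mu> u - Y u)) \<partial>unif01)"
    using transport_cost_le[OF measurable_cost measurable_quantile assms, of \<mu>]
    by (simp add: distr_quantile)
qed

lemma measurable_quantile_at:
  assumes "0 < x" "x < 1"
  shows "(\<lambda>\<mu>. quantile \<mu> x) \<in> borel_measurable P"
proof -
  have "(\<lambda>\<mu>. (\<mu>, x)) \<in> P \<rightarrow>\<^sub>M P \<Otimes>\<^sub>M unif01"
    using assms by (simp add: space_unif01)
  from measurable_compose[OF this measurable_quantile_pair[OF sets_P]]
  show ?thesis by simp
qed

text \<open>Where the cost is infinite at every \<open>y\<close>, every \<open>y\<close> is a minimizer; uniqueness needs a finite
  value. Testing finiteness along one measurable function of the level makes the set Borel.\<close>

definition finite_levels :: "real set" where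
  "finite_levels = {x \<in> {0<..<1}. level_cost x (quantile \<nu>0 x) < \<infinity>}"

lemma finite_levels_borel: "finite_levels \<in> sets borel"
proof -
  have "finite_levels = {u \<in> space unif01. level_cost u (quantile \<nu>0 u) < \<infinity>}"
    by (simp add: finite_levels_def space_unif01)
  also have "\<dots> \<in> sets unif01"
    using measurable_level_cost[OF measurable_quantile[OF \<nu>0]] by measurable
  finally show ?thesis by (simp add: sets_restrict_space_iff)
qed

lemma AE_finite_levels: "AE x in unif01. x \<in> finite_levels"
proof -
  have "(\<integral>\<^sup>+ u. level_cost u (quantile \<nu>0 u) \<partial>unif01) \<noteq> \<infinity>"
    using finite_cost expected_cost_eq[OF \<nu>0] by simp
  then have "AE u in unif01. level_cost u (quantile \<nu>0 u) \<noteq> \<infinity>"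
    by (rule nn_integral_PInf_AE[OF measurable_level_cost[OF measurable_quantile[OF \<nu>0]]])
  moreover have "AE u in unif01. u \<in> {0<..<1}"
    using AE_space[of unif01] by (simp add: space_unif01)
  ultimately show ?thesis
    by eventually_elim (simp add: finite_levels_def less_top)
qed

lemma ex1_minimizer: "x \<in> finite_levels \<Longrightarrow> \<exists>!y. minimizes x y"
  using mean_cost_minimizer_exists[OF prob_P measurable_quantile_at]
    mean_cost_minimizer_unique[OF prob_P measurable_quantile_at]
  unfolding finite_levels_def expected_quantile_cost_def by (simp, blast)

lemma minimizes_iff: "minimizes x y \<longleftrightarrow> (\<forall>z. level_cost x y \<le> level_cost x z)"
  by (auto simp: is_arg_min_def not_less)

lemma minimum_finite: "x \<in> finite_levels \<Longrightarrow> minimizes x y \<Longrightarrow> level_cost x y < \<infinity>"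
  unfolding minimizes_iff finite_levels_def by (auto intro: le_less_trans)

lemma level_cost_exchange:
  assumes "0 < x" "x \<le> x'" "x' < 1" "b \<le> a"
  shows "level_cost x b + level_cost x' a \<le> level_cost x a + level_cost x' b"
proof -
  note [measurable] = measurable_quantile_at[of x] measurable_quantile_at[of x']
  have "level_cost x b + level_cost x' a
      = (\<integral>\<^sup>+ \<mu>. ennreal (g (quantile \<mu> x - b)) + ennreal (g (quantile \<mu> x' - a)) \<partial>P)"
    unfolding expected_quantile_cost_def using assms by (subst nn_integral_add) auto
  also have "\<dots> \<le> (\<integral>\<^sup>+ \<mu>. ennreal (g (quantile \<mu> x - a)) + ennreal (g (quantile \<mu> x' - b)) \<partial>P)"
  proof (rule nn_integral_mono)
    fix \<mu> assume "\<mu> \<in> space P"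
    then have "quantile \<mu> x \<le> quantile \<mu> x'"
      using assms by (intro quantile_mono) (auto simp: space_P)
    from exchange[OF this assms(4)]
    show "ennreal (g (quantile \<mu> x - b)) + ennreal (g (quantile \<mu> x' - a))
        \<le> ennreal (g (quantile \<mu> x - a)) + ennreal (g (quantile \<mu> x' - b))"
      by (simp add: nonneg ennreal_plus[symmetric] del: ennreal_plus)
  qed
  also have "\<dots> = level_cost x a + level_cost x' b"
    unfolding expected_quantile_cost_def using assms by (subst nn_integral_add) auto
  finally show ?thesis .
qed

text \<open>If the minimizers at two levels were in the wrong order, exchanging them would not raise the
  total cost, so the minimizer at the higher level would also minimize the cost at the lower one,
  against uniqueness there.\<close>

lemma minimizer_mono:
  assumes lv: "x \<in> finite_levels" "x' \<in> finite_levels" "x \<le> x'"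
    and a: "minimizes x a" and b: "minimizes x' b"
  shows "a \<le> b"
proof (rule ccontr)
  assume "\<not> a \<le> b"
  then have ba: "b \<le> a" by simp
  have "level_cost x b + level_cost x' a \<le> level_cost x a + level_cost x' b"
    using lv ba by (intro level_cost_exchange) (auto simp: finite_levels_def)
  also have "\<dots> \<le> level_cost x a + level_cost x' a"
    using b by (intro add_left_mono) (simp add: minimizes_iff)
  finally have "level_cost x b \<le> level_cost x a \<or> level_cost x' a = \<infinity>"
    using ennreal_add_left_cancel_le[of "level_cost x' a" "level_cost x b" "level_cost x a"]
    by (auto simp: add.commute)
  moreover have "level_cost x' a < \<infinity>"
  proof -
    have "level_cost x' a \<le> level_cost x b + level_cost x' a" by simp
    also have "\<dots> \<le> level_cost x a + level_cost x' b"
      using lv ba by (intro level_cost_exchange) (auto simp: finite_levels_def)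
    also have "\<dots> < \<infinity>" using minimum_finite[OF lv(1) a] minimum_finite[OF lv(2) b] by simp
    finally show ?thesis .
  qed
  ultimately have "level_cost x b \<le> level_cost x a" by auto
  then have "minimizes x b" using a by (auto simp: minimizes_iff intro: order_trans)
  then have "a = b" using ex1_minimizer[OF lv(1)] a by blast
  then show False using \<open>\<not> a \<le> b\<close> by simp
qed

text \<open>A constant value off the finite levels keeps the function Borel on the whole line.\<close>

definition minimizer :: "real \<Rightarrow> real" where
  "minimizer x = (if x \<in> finite_levels then THE y. minimizes x y else 0)"

lemma minimizer_minimizes: "x \<in> finite_levels \<Longrightarrow> minimizes x (minimizer x)"
  unfolding minimizer_def using theI'[OF ex1_minimizer] by simp

lemma minimizer_unique: "x \<in> finite_levels \<Longrightarrow> minimizes x y \<Longrightarrow> y = minimizer x"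
  using ex1_minimizer minimizer_minimizes by blast

lemma minimizer_borel: "minimizer \<in> borel_measurable borel"
proof -
  have "mono_on finite_levels minimizer"
    using minimizer_mono minimizer_minimizes by (blast intro: mono_onI)
  then have "minimizer \<in> borel_measurable (restrict_space borel finite_levels)"
    by (rule borel_measurable_mono_on_fnc)
  then have "(\<lambda>x. if x \<in> finite_levels then minimizer x else 0) \<in> borel_measurable borel"
    using finite_levels_borel by (subst (asm) measurable_restrict_space_iff[where c = 0]) auto
  moreover have "(\<lambda>x. if x \<in> finite_levels then minimizer x else 0) = minimizer"
    by (auto simp: minimizer_def)
  ultimately show ?thesis by simp
qed

lemma minimizer_measurable: "minimizer \<in> borel_measurable unif01"
  by (intro measurable_restrict_space1) (simp add: minimizer_borel)

definition barycenter :: "real measure" where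
  "barycenter = distr unif01 borel minimizer"

lemma barycenter_prob: "barycenter \<in> prob_measures"
  using U.prob_space_distr[OF minimizer_measurable] by (simp add: barycenter_def prob_measures_def)

lemma integral_minimum_le:
  assumes "\<nu> \<in> prob_measures"
  shows "(\<integral>\<^sup>+ u. level_cost u (minimizer u) \<partial>unif01) \<le> expected_cost g P \<nu>"
  unfolding expected_cost_eq[OF assms]
proof (rule nn_integral_mono_AE)
  show "AE u in unif01. level_cost u (minimizer u) \<le> level_cost u (quantile \<nu> u)"
    using AE_finite_levels
    by eventually_elim (use minimizer_minimizes in \<open>auto simp: minimizes_iff\<close>)
qed

lemma expected_cost_barycenter_le:
  assumes "\<nu> \<in> prob_measures"
  shows "expected_cost g P barycenter \<le> expected_cost g P \<nu>"
  using expected_cost_distr_le[OF minimizer_measurable] integral_minimum_le[OF assms]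
  by (simp add: barycenter_def)

text \<open>A competitor of the same finite total cost must have minimal cost at almost every level, so
  its quantile function is almost everywhere the unique pointwise minimizer.\<close>

lemma barycenter_unique:
  assumes \<nu>: "\<nu> \<in> prob_measures" and le: "expected_cost g P \<nu> \<le> expected_cost g P barycenter"
  shows "\<nu> = barycenter"
proof -
  note q = measurable_quantile[OF \<nu>]
  have fin: "(\<integral>\<^sup>+ u. level_cost u (minimizer u) \<partial>unif01) \<noteq> \<infinity>"
    using integral_minimum_le[OF \<nu>0] finite_cost by auto
  have "expected_cost g P \<nu> \<le> (\<integral>\<^sup>+ u. level_cost u (minimizer u) \<partial>unif01)"
    using le expected_cost_distr_le[OF minimizer_measurable] by (simp add: barycenter_def)
  then have not_less: "\<not> (\<integral>\<^sup>+ u. level_cost u (minimizer u) \<partial>unif01)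
      < (\<integral>\<^sup>+ u. level_cost u (quantile \<nu> u) \<partial>unif01)"
    unfolding expected_cost_eq[OF \<nu>] by (simp add: not_less)
  have ae: "AE u in unif01. level_cost u (minimizer u) \<le> level_cost u (quantile \<nu> u)"
    using AE_finite_levels
    by eventually_elim (use minimizer_minimizes in \<open>auto simp: minimizes_iff\<close>)
  have "AE u in unif01. level_cost u (quantile \<nu> u) \<le> level_cost u (minimizer u)"
    using nn_integral_less[OF measurable_level_cost[OF minimizer_measurable]
        measurable_level_cost[OF q] fin ae] not_less by blast
  then have "AE u in unif01. quantile \<nu> u = minimizer u"
    using AE_finite_levels
  proof eventually_elim
    case (elim u)
    have "minimizes u (quantile \<nu> u)"
      using minimizer_minimizes[OF elim(2)] elim(1) by (auto simp: minimizes_iff intro: order_trans)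
    then show ?case by (rule minimizer_unique[OF elim(2)])
  qed
  then have "distr unif01 borel (quantile \<nu>) = barycenter"
    unfolding barycenter_def by (intro distr_cong_AE q minimizer_measurable) auto
  then show ?thesis by (simp add: distr_quantile[OF \<nu>])
qed

lemma frechet_barycenter_iff: "frechet_barycenter g P \<nu> \<longleftrightarrow> \<nu> = barycenter"
  unfolding frechet_barycenter_def is_arg_min_def
  using barycenter_prob expected_cost_barycenter_le barycenter_unique[of \<nu>]
  by (auto simp: not_less)

end

theorem theorem3:
  fixes g :: "real \<Rightarrow> real" and P :: "real measure measure"
  assumes "strictly_convex g" and "\<And>x. g 0 \<le> g x" and "g 0 = 0"
    and "prob_space P" and "sets P = sets weak_borel"
    and "\<exists>\<nu>\<in>prob_measures. expected_cost g P \<nu> < \<infinity>"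
  shows "\<exists>\<nu>'. (\<forall>\<nu>. frechet_barycenter g P \<nu> \<longleftrightarrow> \<nu> = \<nu>') \<and>
    (AE x in lebesgue_on {0<..<1}. \<exists>!y. is_arg_min (expected_quantile_cost g P x) (\<lambda>_. True) y) \<and>
    (\<forall>\<psi> :: real \<Rightarrow> real.
       (AE x in lebesgue_on {0<..<1}.
          is_arg_min (expected_quantile_cost g P x) (\<lambda>_. True) (\<psi> x)) \<longrightarrow>
       \<psi> \<in> borel_measurable (lebesgue_on {0<..<1}) \<and>
       \<nu>' = distr (lebesgue_on {0<..<1}) borel \<psi>)"
proof -
  obtain \<nu>0 where "\<nu>0 \<in> prob_measures" "expected_cost g P \<nu>0 < \<infinity>"
    using assms(6) by blast
  then interpret random_measure_cost g P \<nu>0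
    using assms(1-5)
    by (intro random_measure_cost.intro strictly_convex_cost.intro random_measure_cost_axioms.intro)
  show ?thesis
    unfolding AE_lebesgue_on_unit_interval
  proof (intro exI[of _ barycenter] conjI allI impI)
    show "frechet_barycenter g P \<nu> \<longleftrightarrow> \<nu> = barycenter" for \<nu>
      by (rule frechet_barycenter_iff)
    show "AE x in unif01. \<exists>!y. minimizes x y"
      using AE_finite_levels by eventually_elim (rule ex1_minimizer)
  next
    fix \<psi> :: "real \<Rightarrow> real" assume "AE x in unif01. minimizes x (\<psi> x)"
    then have ae: "AE x in unif01. \<psi> x = minimizer x"
      using AE_finite_levels by eventually_elim (rule minimizer_unique)
    show "\<psi> \<in> borel_measurable (lebesgue_on {0<..<1})"
      by (rule AE_eq_borel_on_unit_interval[OF minimizer_borel ae])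
    show "barycenter = distr (lebesgue_on {0<..<1}) borel \<psi>"
      unfolding barycenter_def
      by (rule AE_eq_borel_on_unit_interval(2)[OF minimizer_borel ae, symmetric])
  qed
qed

end
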